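(* Let $\alpha\in(0,\infty)\setminus\{1\}$. (i) Let $X,Y$ take values in finite sets and let $p(x,y)$ and $\bar p(x,y)$ be joint probability distributions related by $$\bar p(x,y)=\frac{p(x|y)^\alpha\,p(y)}{\sum_{x',y'}p(x'|y')^\alpha\,p(y')}.$$ Then $$H^H_\alpha(X|Y)_p=H^A_{1/\alpha}(X|Y)_{\bar p}.$$ (ii) Let $X,Y,Z$ take values in finite sets, let $p(x,y,z)$ be a joint probability distribution, and let $$\hat p(x,y,z)=\frac{p(z)\,p(x,y|z)^\alpha}{\sum_{x',y',z'}p(z')\,p(x',y'|z')^\alpha}.$$ Then $$H^H_\alpha(XY|Z)_p=H^A_{1/\alpha}(X|YZ)_{\hat p}+H^H_\alpha(Y|Z)_p=H^A_{1/\alpha}(XY|Z)_{\hat p}.$$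
   Context: For a joint probability distribution $p(x,y)$ on a finite product set, with marginal $p(y)=\sum_x p(x,y)$ and conditional $p(x|y)=p(x,y)/p(y)$, and for $\alpha\in(0,\infty)\setminus\{1\}$, define $$H^H_\alpha(X|Y)_p=\frac{1}{1-\alpha}\log\sum_y\sum_x p(y)\,p(x|y)^\alpha,\qquad H^A_\alpha(X|Y)_p=\frac{\alpha}{1-\alpha}\log\sum_y p(y)\Big(\sum_x p(x|y)^\alpha\Big)^{1/\alpha}.$$ Thus $H^A_{1/\alpha}(X|Y)_p=\frac{1}{\alpha-1}\log\sum_y p(y)\big(\sum_x p(x|y)^{1/\alpha}\big)^{\alpha}$. Terms with $p(y)=0$ are taken to be $0$, and $0^\alpha=0$. $\log$ is the natural logarithm. $H^*_\alpha(XY|Z)_p$ means that the pair $(X,Y)$ is treated as a single variable conditioned on $Z$; $H^*_\alpha(X|YZ)_p$ means $X$ conditioned on the pair $(Y,Z)$; $H^*_\alpha(Y|Z)_p$ is evaluated on the marginal distribution $p(y,z)$. *)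

theory Defs
  imports "HOL-Probability.Probability_Mass_Function"
begin

text \<open>Finite alphabets are types of class finite. A joint distribution of a variable X and a
  conditioning variable Y is a pmf on pairs whose second component is the conditioning variable.\<close>

abbreviation marg :: "('x \<times> 'y) pmf \<Rightarrow> 'y \<Rightarrow> real" where
  "marg p y \<equiv> pmf (map_pmf snd p) y"

lemma marg_eq_sum:
  fixes p :: "('x::finite \<times> 'y) pmf"
  shows "marg p y = (\<Sum>x\<in>UNIV. pmf p (x, y))"
proof -
  have "marg p y = measure p (snd -` {y})"
    by (simp add: pmf_map)
  also have "snd -` {y} = (\<lambda>x. (x, y)) ` (UNIV :: 'x set)"
    by auto
  also have "measure p \<dots> = (\<Sum>z\<in>(\<lambda>x. (x, y)) ` UNIV. pmf p z)"
    by (rule measure_measure_pmf_finite) simp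
  also have "\<dots> = (\<Sum>x\<in>UNIV. pmf p (x, y))"
    by (subst sum.reindex) (auto simp: inj_on_def)
  finally show ?thesis .
qed

text \<open>Here \<open>cprob p x y\<close> is p(x|y). It is 0 when the marginal of y vanishes, because
  division by zero yields 0. In all formulas below \<open>0 powr a = 0\<close>, and so terms with p(y) = 0
  contribute 0.\<close>

definition cprob :: "('x \<times> 'y) pmf \<Rightarrow> 'x \<Rightarrow> 'y \<Rightarrow> real" where
  "cprob p x y = pmf p (x, y) / marg p y"

definition cond_entropy_H :: "real \<Rightarrow> ('x::finite \<times> 'y::finite) pmf \<Rightarrow> real" where
  "cond_entropy_H \<alpha> p =
     1 / (1 - \<alpha>) * ln (\<Sum>y\<in>UNIV. \<Sum>x\<in>UNIV. marg p y * cprob p x y powr \<alpha>)"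

definition cond_entropy_A :: "real \<Rightarrow> ('x::finite \<times> 'y::finite) pmf \<Rightarrow> real" where
  "cond_entropy_A \<alpha> p =
     \<alpha> / (1 - \<alpha>) *
       ln (\<Sum>y\<in>UNIV. marg p y * (\<Sum>x\<in>UNIV. cprob p x y powr \<alpha>) powr (1 / \<alpha>))"

text \<open>A distribution of (X,Y,Z) has the right-nested type \<open>('x \<times> 'y \<times> 'z) pmf\<close>, so it is
  directly a joint distribution of X and the pair (Y,Z), and \<open>map_pmf snd\<close> yields the marginal
  of (Y,Z). The regrouping below makes the pair (X,Y) a single variable conditioned on Z.\<close>

definition pair_XY :: "('x \<times> 'y \<times> 'z) pmf \<Rightarrow> (('x \<times> 'y) \<times> 'z) pmf" where
  "pair_XY p = map_pmf (\<lambda>(x, y, z). ((x, y), z)) p"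

lemma pmf_pair_XY: "pmf (pair_XY p) ((x, y), z) = pmf p (x, y, z)"
proof -
  have "inj (\<lambda>(x, y, z). ((x, y), z))"
    by (auto simp: inj_def)
  from pmf_map_inj'[OF this, of p "(x, y, z)"] show ?thesis
    by (simp add: pair_XY_def)
qed

lemma marg_pair_XY: "marg (pair_XY p) z = pmf (map_pmf (\<lambda>(x, y, z). z) p) z"
  by (simp add: pair_XY_def map_pmf_comp case_prod_unfold)

definition hat_pmf ::
  "real \<Rightarrow> ('x::finite \<times> 'y::finite \<times> 'z::finite) pmf \<Rightarrow> ('x \<times> 'y \<times> 'z) pmf" where
  "hat_pmf \<alpha> p = embed_pmf (\<lambda>(x, y, z).
     marg (pair_XY p) z * cprob (pair_XY p) (x, y) z powr \<alpha> /
     (\<Sum>(x', y', z')\<in>UNIV. marg (pair_XY p) z' * cprob (pair_XY p) (x', y') z' powr \<alpha>))"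

text \<open>The weights in \<open>hat_pmf\<close> do form a probability distribution, so \<open>embed_pmf\<close> is used
  within its domain.\<close>

lemma pmf_hat_pmf:
  "pmf (hat_pmf \<alpha> p) (x, y, z) =
     marg (pair_XY p) z * cprob (pair_XY p) (x, y) z powr \<alpha> /
     (\<Sum>(x', y', z')\<in>UNIV. marg (pair_XY p) z' * cprob (pair_XY p) (x', y') z' powr \<alpha>)"
proof -
  define w where "w = (\<lambda>(x, y, z). marg (pair_XY p) z * cprob (pair_XY p) (x, y) z powr \<alpha>)"
  define N where "N = sum w UNIV"
  have w_nonneg: "0 \<le> w t" for t
    by (auto simp: w_def split: prod.split)
  obtain a b c where abc: "(a, b, c) \<in> set_pmf p"
    using set_pmf_not_empty[of p] by auto
  then have "c \<in> set_pmf (map_pmf snd (pair_XY p))"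
    by (force simp: pair_XY_def)
  then have "0 < marg (pair_XY p) c"
    by (rule pmf_positive)
  moreover have "0 < pmf p (a, b, c)"
    using abc by (rule pmf_positive)
  ultimately have "0 < w (a, b, c)"
    by (simp add: w_def cprob_def pmf_pair_XY)
  then have N_pos: "0 < N"
    unfolding N_def by (intro sum_pos2[of _ "(a, b, c)"]) (auto simp: w_nonneg)
  have "(\<Sum>t\<in>UNIV. w t / N) = 1"
    using N_pos by (simp add: N_def flip: sum_divide_distrib)
  then have "(\<integral>\<^sup>+t. ennreal (w t / N) \<partial>count_space UNIV) = 1"
    using w_nonneg N_pos by (simp add: nn_integral_count_space_finite sum_ennreal)
  then have *: "pmf (embed_pmf (\<lambda>t. w t / N)) t = w t / N" for t
    using w_nonneg N_pos by (intro pmf_embed_pmf) auto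
  have "hat_pmf \<alpha> p = embed_pmf (\<lambda>t. w t / N)"
    unfolding hat_pmf_def N_def w_def by (rule arg_cong[of _ _ embed_pmf]) auto
  with * show ?thesis
    by (simp add: N_def w_def)
qed

end

theory Submission
  imports Defs
begin

text \<open>The marginal cancels from the Arimoto sum: up to a factor it is the logarithm of
  \<open>\<Sum>y. (\<Sum>x. q(x,y) powr \<alpha>) powr (1/\<alpha>)\<close>. For a tilted distribution
  \<open>q(x,y) = c(y) * a(x,y) powr \<alpha>\<close>, taken at order \<open>1/\<alpha>\<close>, the inner powers undo the tilting and
  leave \<open>c(y) * (\<Sum>x. a(x,y)) powr \<alpha>\<close>, in which only the sum of the conditional
  probabilities \<open>a(x,y)\<close> over \<open>x\<close> enters.\<close>

lemma cprob_nonneg [simp]: "0 \<le> cprob p x y"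
  by (simp add: cprob_def)

text \<open>The value 0 comes from division by zero. It does no harm later, where the sum is
  multiplied by the marginal of \<open>y\<close>.\<close>

lemma sum_cprob:
  fixes p :: "('x::finite \<times> 'y) pmf"
  shows "(\<Sum>x\<in>UNIV. cprob p x y) = (if marg p y = 0 then 0 else 1)"
  unfolding cprob_def by (simp add: marg_eq_sum flip: sum_divide_distrib)

text \<open>This quantity has two roles: the argument of the logarithm in
  \<open>cond_entropy_H\<close>, and the normalizer of the tilted distribution.\<close>

definition H_sum :: "real \<Rightarrow> ('x::finite \<times> 'y::finite) pmf \<Rightarrow> real" where
  "H_sum \<alpha> p = (\<Sum>y\<in>UNIV. \<Sum>x\<in>UNIV. marg p y * cprob p x y powr \<alpha>)"

lemma cond_entropy_H_eq: "cond_entropy_H \<alpha> p = 1 / (1 - \<alpha>) * ln (H_sum \<alpha> p)"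
  by (simp add: cond_entropy_H_def H_sum_def)

lemma H_sum_eq_UNIV: "H_sum \<alpha> p = (\<Sum>(x, y)\<in>UNIV. marg p y * cprob p x y powr \<alpha>)"
  unfolding H_sum_def by (subst sum.swap) (simp add: sum.cartesian_product)

text \<open>Any atom of \<open>p\<close> contributes a positive term. This licenses dividing by the
  normalizer and splitting logarithms of quotients.\<close>

lemma H_sum_pos: "0 < H_sum \<alpha> p"
proof -
  obtain x y where xy: "(x, y) \<in> set_pmf p"
    using set_pmf_not_empty[of p] by auto
  then have "y \<in> set_pmf (map_pmf snd p)"
    by force
  then have "0 < marg p y"
    by (rule pmf_positive)
  then have "0 < marg p y * cprob p x y powr \<alpha>"
    using pmf_positive[OF xy] by (simp add: cprob_def)
  then show ?thesis
    unfolding H_sum_eq_UNIV by (intro sum_pos2[of _ "(x, y)"]) auto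
qed

text \<open>The denominators leave the inner sum as \<open>marg q y powr \<beta>\<close>; the outer
  power reduces this to \<open>marg q y\<close>, which cancels the weight in front.\<close>

lemma marg_mult_powr_sum_cprob:
  fixes q :: "('x::finite \<times> 'y) pmf"
  assumes "0 < \<beta>"
  shows "marg q y * (\<Sum>x\<in>UNIV. cprob q x y powr \<beta>) powr (1 / \<beta>) =
    (\<Sum>x\<in>UNIV. pmf q (x, y) powr \<beta>) powr (1 / \<beta>)"
proof (cases "marg q y = 0")
  case True
  \<comment> \<open>A vanishing marginal forces every joint probability over \<open>y\<close> to
    vanish, so the right-hand side is 0 as well.\<close>
  then have "pmf q (x, y) = 0" for x
    by (simp add: marg_eq_sum sum_nonneg_eq_0_iff)
  with True show ?thesis by simp
next
  case False
  then have pos: "0 < marg q y"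
    by (simp add: order.not_eq_order_implies_strict)
  have "(\<Sum>x\<in>UNIV. cprob q x y powr \<beta>) = (\<Sum>x\<in>UNIV. pmf q (x, y) powr \<beta>) / marg q y powr \<beta>"
    by (simp add: cprob_def powr_divide sum_divide_distrib)
  then show ?thesis
    using pos assms by (simp add: powr_divide powr_powr sum_nonneg)
qed

text \<open>The prefactor is written as the negative of the one in \<open>cond_entropy_H\<close>, so
  that only the logarithms remain to be compared.\<close>

lemma cond_entropy_A_inverse_eq:
  assumes "0 < \<alpha>" "\<alpha> \<noteq> 1"
  shows "cond_entropy_A (1 / \<alpha>) q =
    - (1 / (1 - \<alpha>) * ln (\<Sum>y\<in>UNIV. (\<Sum>x\<in>UNIV. pmf q (x, y) powr (1 / \<alpha>)) powr \<alpha>))"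
proof -
  have "(1 / \<alpha>) / (1 - 1 / \<alpha>) = - (1 / (1 - \<alpha>))"
    using assms by (simp add: field_simps)
  then show ?thesis
    using assms marg_mult_powr_sum_cprob[of "1 / \<alpha>" q]
    unfolding cond_entropy_A_def by simp
qed

lemma powr_sum_tilted:
  fixes a :: "'i \<Rightarrow> real"
  assumes "0 < \<alpha>" "0 \<le> c" "\<And>x. x \<in> S \<Longrightarrow> 0 \<le> a x"
  shows "(\<Sum>x\<in>S. (c * a x powr \<alpha>) powr (1 / \<alpha>)) powr \<alpha> = c * (\<Sum>x\<in>S. a x) powr \<alpha>"
proof -
  have "(\<Sum>x\<in>S. (c * a x powr \<alpha>) powr (1 / \<alpha>)) = c powr (1 / \<alpha>) * (\<Sum>x\<in>S. a x)"
    unfolding sum_distrib_left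
    using assms by (intro sum.cong) (auto simp: powr_mult powr_powr)
  then show ?thesis
    using assms by (simp add: powr_mult powr_powr sum_nonneg)
qed

lemma sum_marg: "(\<Sum>y\<in>UNIV. marg (p :: ('x \<times> 'y::finite) pmf) y) = 1"
  by (rule sum_pmf_eq_1) auto

text \<open>Conditional probabilities sum to 1 over the whole variable, so each \<open>y\<close>
  contributes its marginal over the normalizer N. The total is 1/N, and its logarithm absorbs the
  minus sign.\<close>

lemma cond_entropy_H_eq_A_tilted:
  fixes p q :: "('x::finite \<times> 'y::finite) pmf"
  assumes \<alpha>: "0 < \<alpha>" "\<alpha> \<noteq> 1"
    and q: "\<And>x y. pmf q (x, y) = marg p y * cprob p x y powr \<alpha> / H_sum \<alpha> p"
  shows "cond_entropy_H \<alpha> p = cond_entropy_A (1 / \<alpha>) q"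
proof -
  let ?N = "H_sum \<alpha> p"
  have "(\<Sum>x\<in>UNIV. pmf q (x, y) powr (1 / \<alpha>)) powr \<alpha> = marg p y / ?N" for y
    using powr_sum_tilted[of \<alpha> "marg p y / ?N" UNIV "\<lambda>x. cprob p x y"] \<alpha> H_sum_pos[of \<alpha> p]
    by (simp add: q sum_cprob split: if_splits)
  then have "cond_entropy_A (1 / \<alpha>) q = - (1 / (1 - \<alpha>) * ln (1 / ?N))"
    by (simp add: cond_entropy_A_inverse_eq[OF \<alpha>] sum_marg flip: sum_divide_distrib)
  then show ?thesis
    using H_sum_pos[of \<alpha> p] by (simp add: cond_entropy_H_eq ln_div)
qed

lemma marg_snd_eq_pair_XY: "marg (map_pmf snd r) z = marg (pair_XY r) z"
  by (simp add: marg_pair_XY map_pmf_comp case_prod_unfold)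

text \<open>Summing out only \<open>x\<close> leaves p(y|z) instead of 1, which is how H(Y|Z) enters
  the chain rule. Both sides share the denominator p(z), so a zero marginal needs no separate
  case.\<close>

lemma sum_cprob_pair_XY:
  fixes r :: "('u::finite \<times> 'v \<times> 'w) pmf"
  shows "(\<Sum>x\<in>UNIV. cprob (pair_XY r) (x, y) z) = cprob (map_pmf snd r) y z"
proof -
  have "pmf (map_pmf snd r) (y, z) = (\<Sum>x\<in>UNIV. pmf r (x, y, z))"
    by (rule marg_eq_sum)
  then show ?thesis
    unfolding cprob_def marg_snd_eq_pair_XY pmf_pair_XY by (simp add: sum_divide_distrib)
qed

text \<open>Regrouping triples in the normalizer exhibits \<open>hat_pmf\<close> as the tilting of
  \<open>pair_XY r\<close>.\<close>

lemma pmf_hat_pmf_H_sum: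
  "pmf (hat_pmf \<alpha> r) (x, y, z) =
    marg (pair_XY r) z * cprob (pair_XY r) (x, y) z powr \<alpha> / H_sum \<alpha> (pair_XY r)"
proof -
  have "(\<Sum>(x, y, z)\<in>UNIV. marg (pair_XY r) z * cprob (pair_XY r) (x, y) z powr \<alpha>) =
      H_sum \<alpha> (pair_XY r)"
    unfolding H_sum_eq_UNIV
    by (rule sum.reindex_bij_witness[of _ "\<lambda>((x, y), z). (x, y, z)" "\<lambda>(x, y, z). ((x, y), z)"])
      auto
  then show ?thesis
    by (simp only: pmf_hat_pmf)
qed

lemma cond_entropy_A_hat_pmf:
  assumes \<alpha>: "0 < \<alpha>" "\<alpha> \<noteq> 1"
  shows "cond_entropy_A (1 / \<alpha>) (hat_pmf \<alpha> r) =
    cond_entropy_H \<alpha> (pair_XY r) - cond_entropy_H \<alpha> (map_pmf snd r)"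
proof -
  let ?N = "H_sum \<alpha> (pair_XY r)" and ?M = "H_sum \<alpha> (map_pmf snd r)"
  \<comment> \<open>The constant p(z)/N does not depend on \<open>x\<close>, so it can be pulled
    out; what remains is the summand of the H-sum of (Y,Z), divided by N.\<close>
  have "(\<Sum>x\<in>UNIV. pmf (hat_pmf \<alpha> r) (x, y, z) powr (1 / \<alpha>)) powr \<alpha> =
      marg (map_pmf snd r) z * cprob (map_pmf snd r) y z powr \<alpha> / ?N" for y z
    using powr_sum_tilted[of \<alpha> "marg (pair_XY r) z / ?N" UNIV "\<lambda>x. cprob (pair_XY r) (x, y) z"]
      \<alpha> H_sum_pos[of \<alpha> "pair_XY r"]
    unfolding pmf_hat_pmf_H_sum sum_cprob_pair_XY marg_snd_eq_pair_XY by simp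
  then have "(\<Sum>yz\<in>UNIV. (\<Sum>x\<in>UNIV. pmf (hat_pmf \<alpha> r) (x, yz) powr (1 / \<alpha>)) powr \<alpha>) = ?M / ?N"
    unfolding H_sum_eq_UNIV[of _ "map_pmf snd r"] sum_divide_distrib
    by (intro sum.cong) auto
  then have "cond_entropy_A (1 / \<alpha>) (hat_pmf \<alpha> r) = - (1 / (1 - \<alpha>) * ln (?M / ?N))"
    by (simp only: cond_entropy_A_inverse_eq[OF \<alpha>])
  also have "ln (?M / ?N) = ln ?M - ln ?N"
    by (simp add: ln_divide_pos H_sum_pos)
  finally show ?thesis
    by (simp add: cond_entropy_H_eq diff_divide_distrib)
qed

theorem mainTheorem1:
  fixes \<alpha> :: real
    and p pbar :: "('x::finite \<times> 'y::finite) pmf"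
    and r :: "('u::finite \<times> 'v::finite \<times> 'w::finite) pmf"
  assumes "0 < \<alpha>" and "\<alpha> \<noteq> 1"
  shows "((\<forall>x y. pmf pbar (x, y) =
            cprob p x y powr \<alpha> * marg p y /
            (\<Sum>(x', y')\<in>UNIV. cprob p x' y' powr \<alpha> * marg p y'))
          \<longrightarrow> cond_entropy_H \<alpha> p = cond_entropy_A (1 / \<alpha>) pbar)
       \<and> (cond_entropy_H \<alpha> (pair_XY r) =
            cond_entropy_A (1 / \<alpha>) (hat_pmf \<alpha> r) + cond_entropy_H \<alpha> (map_pmf snd r)
          \<and> cond_entropy_A (1 / \<alpha>) (hat_pmf \<alpha> r) + cond_entropy_H \<alpha> (map_pmf snd r) =
            cond_entropy_A (1 / \<alpha>) (pair_XY (hat_pmf \<alpha> r)))"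
proof (intro conjI impI)
  assume pbar: "\<forall>x y. pmf pbar (x, y) =
      cprob p x y powr \<alpha> * marg p y / (\<Sum>(x', y')\<in>UNIV. cprob p x' y' powr \<alpha> * marg p y')"
  show "cond_entropy_H \<alpha> p = cond_entropy_A (1 / \<alpha>) pbar"
    by (rule cond_entropy_H_eq_A_tilted[OF assms])
      (simp only: pbar[rule_format] H_sum_eq_UNIV mult.commute)
next
  show hat: "cond_entropy_H \<alpha> (pair_XY r) =
      cond_entropy_A (1 / \<alpha>) (hat_pmf \<alpha> r) + cond_entropy_H \<alpha> (map_pmf snd r)"
    by (simp add: cond_entropy_A_hat_pmf[OF assms])
  \<comment> \<open>This is part (i) with the pair (X,Y) as a single variable.\<close>
  have "cond_entropy_H \<alpha> (pair_XY r) = cond_entropy_A (1 / \<alpha>) (pair_XY (hat_pmf \<alpha> r))"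
    by (rule cond_entropy_H_eq_A_tilted[OF assms])
      (auto simp only: split_paired_all pmf_pair_XY pmf_hat_pmf_H_sum)
  with hat show "cond_entropy_A (1 / \<alpha>) (hat_pmf \<alpha> r) + cond_entropy_H \<alpha> (map_pmf snd r) =
      cond_entropy_A (1 / \<alpha>) (pair_XY (hat_pmf \<alpha> r))"
    by simp
qed

end
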